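(* Every sequent $\vdash A_1,\dots,A_n$ that is derivable from the axioms and rules listed in the context is valid in every Q-structure under every assignment of facts to the propositional letters.
   Context: A Q-structure is a tuple $\langle \mathcal P,\mathcal Z,\cdot,1\rangle$ where $\mathcal P$ is a set, $\mathcal Z\subseteq\mathcal P$, $\cdot$ is a binary operation on $\mathcal P$ (not assumed associative or commutative), and $1\in\mathcal P$. These satisfy, for all $x,y,z\in\mathcal P$: (a) $x\cdot y\in\mathcal Z$ iff $y\cdot x\in\mathcal Z$; (b) $(x\cdot y)\cdot z\in\mathcal Z$ iff $x\cdot(z\cdot y)\in\mathcal Z$; and $1\cdot x=x\cdot 1=x$. For $A\subseteq\mathcal P$ let $A^\perp=\{b\in\mathcal P: b\cdot a\in\mathcal Z \text{ for all } a\in A\}$. A fact is a set $F$ with $F=(F^\perp)^\perp$. For $A,B\subseteq\mathcal P$ let $A\cdot B=\{a\cdot b: a\in A,b\in B\}$. Operations on facts: - $\sim F=F^\perp$; - $F\otimes G=((F\cdot G)^\perp)^\perp$; - $F\wp G=(F^\perp\cdot G^\perp)^\perp$ ("par"); - $F\& G=F\cap G$; - $F\oplus G=((F\cup G)^\perp)^\perp$. Formulas are built from propositional letters $a$ and their negations $\sim a$, the constants $\mathbf 1,\top$ and their negations $\sim\mathbf 1,\sim\top$, using the binary connectives $\otimes,\wp,\&,\oplus$. Negation of a compound formula is defined by De Morgan duality: $\sim(A\otimes B)=\sim A\wp\sim B$, $\sim(A\wp B)=\sim A\otimes\sim B$, $\sim(A\& B)=\sim A\oplus\sim B$, $\sim(A\oplus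 B)=\sim A\&\sim B$, and $\sim\sim A=A$. An assignment gives each letter a fact. Formulas are then interpreted as facts: $\mathbf 1$ as $\mathcal Z^\perp$, $\top$ as $\mathcal P$, $\sim$ as $^\perp$, and each connective by the corresponding operation above. A sequent $\vdash A_1,\dots,A_n$ ($n\ge1$) is valid in the structure under the assignment iff the element $1$ belongs to the interpretation of $(\cdots(A_1\wp A_2)\wp\cdots)\wp A_n$, associated to the left. Axioms and rules, where $A,B,C,D$ are formulas and $\sigma$ is a finite sequence of formulas: - Logical axiom: $\vdash\sim A,A$. - Cut: from $\vdash A,B$ and $\vdash\sim A,C$ infer $\vdash B,C$. - Exchange1: from $\vdash A_1,A_2$ infer $\vdash A_2,A_1$. - Exchange2: from $\vdash A_1,A_2,A_3$ infer $\vdash A_3,A_2,A_1$. - Axiom $\top$: $\vdash\top,A$. - $\&$: from $\vdash A,C$ and $\vdash B,C$ infer $\vdash A\& B,C$. - $\oplus1$: from $\vdash A,C$ infer $\vdash A\oplus B,C$. - $\oplus2$: from $\vdash A,C$ infer $\vdash B\oplus A,C$. - Axiom1: $\vdash\mathbf 1$. - $\bot$: from $\vdash A$ infer $\vdash\sim\mathbf 1,A$. - $\otimes$: from $\vdash A,C$ and $\vdash B,D$ infer $\vdash C,D,A\otimes B$. - $\wp$: from $\vdash A,B,\sigma$ infer $\vdash A\wp B,\sigma$. *)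

theory Defs
  imports Main
begin

datatype 'a form =
    Letter 'a
  | NegLetter 'a
  | One
  | Top
  | NegOne
  | NegTop
  | Tensor "'a form" "'a form"
  | Par "'a form" "'a form"
  | With "'a form" "'a form"
  | Plus "'a form" "'a form"

primrec neg :: "'a form \<Rightarrow> 'a form" where
  "neg (Letter a) = NegLetter a"
| "neg (NegLetter a) = Letter a"
| "neg One = NegOne"
| "neg NegOne = One"
| "neg Top = NegTop"
| "neg NegTop = Top"
| "neg (Tensor A B) = Par (neg A) (neg B)"
| "neg (Par A B) = Tensor (neg A) (neg B)"
| "neg (With A B) = Plus (neg A) (neg B)"
| "neg (Plus A B) = With (neg A) (neg B)"

lemma neg_neg: "neg (neg A) = A"
  by (induction A) simp_all

text \<open>Contexts are single formulas in every rule except \<open>par\<close>, and exchange is available only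
  for sequents of length two and three.\<close>

inductive derivable :: "'a form list \<Rightarrow> bool" where
  ax: "derivable [neg A, A]"
| cut: "derivable [A, B] \<Longrightarrow> derivable [neg A, C] \<Longrightarrow> derivable [B, C]"
| exchange1: "derivable [A1, A2] \<Longrightarrow> derivable [A2, A1]"
| exchange2: "derivable [A1, A2, A3] \<Longrightarrow> derivable [A3, A2, A1]"
| top: "derivable [Top, A]"
| "with": "derivable [A, C] \<Longrightarrow> derivable [B, C] \<Longrightarrow> derivable [With A B, C]"
| plus1: "derivable [A, C] \<Longrightarrow> derivable [Plus A B, C]"
| plus2: "derivable [A, C] \<Longrightarrow> derivable [Plus B A, C]"
| one: "derivable [One]"
| bot: "derivable [A] \<Longrightarrow> derivable [neg One, A]"
| tensor: "derivable [A, C] \<Longrightarrow> derivable [B, D] \<Longrightarrow> derivable [C, D, Tensor A B]"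
| par: "derivable (A # B # \<sigma>) \<Longrightarrow> derivable (Par A B # \<sigma>)"

locale q_structure =
  fixes P :: "'p set"
    and Z :: "'p set"
    and mult :: "'p \<Rightarrow> 'p \<Rightarrow> 'p" (infixl \<open>\<cdot>\<close> 70)
    and unit :: 'p
  assumes Z_subset: "Z \<subseteq> P"
    and mult_closed: "x \<in> P \<Longrightarrow> y \<in> P \<Longrightarrow> x \<cdot> y \<in> P"
    and unit_closed: "unit \<in> P"
    and swap: "x \<in> P \<Longrightarrow> y \<in> P \<Longrightarrow> x \<cdot> y \<in> Z \<longleftrightarrow> y \<cdot> x \<in> Z"
    and shift: "x \<in> P \<Longrightarrow> y \<in> P \<Longrightarrow> z \<in> P \<Longrightarrow> (x \<cdot> y) \<cdot> z \<in> Z \<longleftrightarrow> x \<cdot> (z \<cdot> y) \<in> Z"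
    and unit_left: "x \<in> P \<Longrightarrow> unit \<cdot> x = x"
    and unit_right: "x \<in> P \<Longrightarrow> x \<cdot> unit = x"
begin

definition perp :: "'p set \<Rightarrow> 'p set" where
  "perp A = {b \<in> P. \<forall>a\<in>A. b \<cdot> a \<in> Z}"

definition fact :: "'p set \<Rightarrow> bool" where
  "fact F \<longleftrightarrow> F \<subseteq> P \<and> F = perp (perp F)"

definition set_mult :: "'p set \<Rightarrow> 'p set \<Rightarrow> 'p set" where
  "set_mult A B = {a \<cdot> b | a b. a \<in> A \<and> b \<in> B}"

definition tensor_fact :: "'p set \<Rightarrow> 'p set \<Rightarrow> 'p set" where
  "tensor_fact F G = perp (perp (set_mult F G))"

definition par_fact :: "'p set \<Rightarrow> 'p set \<Rightarrow> 'p set" where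
  "par_fact F G = perp (set_mult (perp F) (perp G))"

definition with_fact :: "'p set \<Rightarrow> 'p set \<Rightarrow> 'p set" where
  "with_fact F G = F \<inter> G"

definition plus_fact :: "'p set \<Rightarrow> 'p set \<Rightarrow> 'p set" where
  "plus_fact F G = perp (perp (F \<union> G))"

primrec interp :: "('a \<Rightarrow> 'p set) \<Rightarrow> 'a form \<Rightarrow> 'p set" where
  "interp v (Letter a) = v a"
| "interp v (NegLetter a) = perp (v a)"
| "interp v One = perp Z"
| "interp v Top = P"
| "interp v NegOne = perp (perp Z)"
| "interp v NegTop = perp P"
| "interp v (Tensor A B) = tensor_fact (interp v A) (interp v B)"
| "interp v (Par A B) = par_fact (interp v A) (interp v B)"
| "interp v (With A B) = with_fact (interp v A) (interp v B)"
| "interp v (Plus A B) = plus_fact (interp v A) (interp v B)"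

text \<open>Sequents are nonempty; the empty list is declared not valid.\<close>

primrec valid :: "('a \<Rightarrow> 'p set) \<Rightarrow> 'a form list \<Rightarrow> bool" where
  "valid v [] \<longleftrightarrow> False"
| "valid v (A # \<Gamma>) \<longleftrightarrow> unit \<in> interp v (foldl Par A \<Gamma>)"

end

end

(* The map perp is the polarity of the symmetric relation "x \<cdot> y \<in> Z" on P, so perp (perp _) is a
   closure operator and negation of formulas is interpreted by perp.  Since 1 is a unit, a
   two-formula sequent A, B is valid iff perp A \<subseteq> B, which turns cut into transitivity of inclusion
   and the additive rules into lattice facts.  A three-formula sequent A, B, C is valid iff
   (a \<cdot> b) \<cdot> c \<in> Z for all a, b, c in the respective perps, and conditions (a) and (b) make this
   invariant under exchanging a and c. *)
theory Submission
  imports Defs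
begin

context q_structure
begin

lemma perp_subset: "perp A \<subseteq> P"
  by (auto simp: perp_def)

lemma perp_antimono: "A \<subseteq> B \<Longrightarrow> perp B \<subseteq> perp A"
  by (auto simp: perp_def)

lemma subset_perp_iff:
  assumes "A \<subseteq> P"
  shows "A \<subseteq> perp B \<longleftrightarrow> (\<forall>a\<in>A. \<forall>b\<in>B. a \<cdot> b \<in> Z)"
  using assms by (auto simp: perp_def)

text \<open>Condition (a) makes the relation symmetric, so \<open>perp\<close> forms a Galois
  connection with itself; the closure laws below follow from this.\<close>

lemma subset_perp_commute:
  assumes "A \<subseteq> P" "B \<subseteq> P"
  shows "A \<subseteq> perp B \<longleftrightarrow> B \<subseteq> perp A"
  using assms swap by (simp add: subset_perp_iff) (meson subsetD)

lemma subset_perp_perp: "A \<subseteq> P \<Longrightarrow> A \<subseteq> perp (perp A)"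
  using subset_perp_commute[of A "perp A"] perp_subset by blast

lemma perp_perp_perp: "A \<subseteq> P \<Longrightarrow> perp (perp (perp A)) = perp A"
  by (meson perp_antimono perp_subset subset_antisym subset_perp_perp)

lemma perp_Un: "perp (A \<union> B) = perp A \<inter> perp B"
  by (auto simp: perp_def)

lemma perp_plus_fact: "F \<subseteq> P \<Longrightarrow> G \<subseteq> P \<Longrightarrow> perp (plus_fact F G) = perp F \<inter> perp G"
  unfolding plus_fact_def by (subst perp_perp_perp) (simp_all add: perp_Un)

lemma set_mult_subset: "A \<subseteq> P \<Longrightarrow> B \<subseteq> P \<Longrightarrow> set_mult A B \<subseteq> P"
  by (auto simp: set_mult_def intro: mult_closed)

lemma fact_subset: "fact F \<Longrightarrow> F \<subseteq> P"
  by (simp add: fact_def)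

lemma fact_perp_perp: "fact F \<Longrightarrow> perp (perp F) = F"
  by (simp add: fact_def)

lemma fact_perp: "A \<subseteq> P \<Longrightarrow> fact (perp A)"
  by (simp add: fact_def perp_subset perp_perp_perp)

lemma fact_P: "fact P"
  using subset_perp_perp[of P] perp_subset by (auto simp: fact_def)

lemma fact_Int:
  assumes "fact F" "fact G"
  shows "fact (F \<inter> G)"
proof -
  have "F \<inter> G = perp (perp F \<union> perp G)"
    using assms by (simp add: perp_Un fact_perp_perp)
  then show ?thesis
    by (simp add: fact_perp perp_subset)
qed

lemma fact_interp:
  assumes "\<And>a. fact (v a)"
  shows "fact (interp v A)"
  by (induction A)
    (simp_all add: assms fact_perp fact_P fact_Int fact_subset Z_subset perp_subset
      set_mult_subset tensor_fact_def par_fact_def with_fact_def plus_fact_def)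

text \<open>De Morgan duality survives interpretation because every interpreted formula is a fact,
  so double perps cancel.\<close>

lemma interp_neg:
  assumes "\<And>a. fact (v a)"
  shows "interp v (neg A) = perp (interp v A)"
proof (induction A)
  case (With A B)
  have "interp v A \<inter> interp v B = perp (perp (interp v A) \<union> perp (interp v B))"
    using fact_interp[of v, OF assms] by (simp add: perp_Un fact_perp_perp)
  with With show ?case
    by (simp add: with_fact_def plus_fact_def)
qed (simp_all add: assms fact_perp_perp fact_interp[of v, OF assms] fact_P fact_subset
      perp_perp_perp Z_subset perp_subset set_mult_subset
      tensor_fact_def par_fact_def with_fact_def perp_plus_fact)

text \<open>Multiplying by \<open>unit\<close> changes nothing, so membership says that
  \<open>perp F\<close> and \<open>perp G\<close> are orthogonal; for a fact \<open>G\<close> this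
  is an inclusion.\<close>

lemma unit_mem_par_fact:
  assumes "fact G"
  shows "unit \<in> par_fact F G \<longleftrightarrow> perp F \<subseteq> G"
proof -
  have "unit \<in> par_fact F G \<longleftrightarrow> (\<forall>a\<in>perp F. \<forall>b\<in>perp G. unit \<cdot> (a \<cdot> b) \<in> Z)"
    unfolding par_fact_def perp_def[of "set_mult (perp F) (perp G)"]
    by (auto simp: set_mult_def unit_closed)
  also have "\<dots> \<longleftrightarrow> (\<forall>a\<in>perp F. \<forall>b\<in>perp G. a \<cdot> b \<in> Z)"
    using perp_subset by (metis mult_closed subsetD unit_left)
  also have "\<dots> \<longleftrightarrow> perp F \<subseteq> perp (perp G)"
    by (simp add: subset_perp_iff perp_subset)
  finally show ?thesis
    using assms by (simp add: fact_perp_perp)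
qed

text \<open>The perp of the inner par is the closure of a product set. Being included in the closed
  set \<open>H\<close> does not distinguish a set from its closure, so testing plain products
  suffices.\<close>

lemma unit_mem_par_fact3:
  assumes "fact H"
  shows "unit \<in> par_fact (par_fact F G) H \<longleftrightarrow>
    (\<forall>a\<in>perp F. \<forall>b\<in>perp G. \<forall>c\<in>perp H. (a \<cdot> b) \<cdot> c \<in> Z)"
proof -
  let ?M = "set_mult (perp F) (perp G)"
  have M: "?M \<subseteq> P"
    by (simp add: perp_subset set_mult_subset)
  have H: "H = perp (perp H)" "perp H \<subseteq> P"
    using assms by (simp_all add: fact_perp_perp perp_subset)
  have "unit \<in> par_fact (par_fact F G) H \<longleftrightarrow> perp (perp ?M) \<subseteq> perp (perp H)"
    using unit_mem_par_fact[OF assms, of "par_fact F G"] H(1) by (simp add: par_fact_def)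
  also have "\<dots> \<longleftrightarrow> ?M \<subseteq> perp (perp H)"
    by (metis H(2) M perp_antimono subset_perp_perp subset_trans)
  also have "\<dots> \<longleftrightarrow> (\<forall>m\<in>?M. \<forall>c\<in>perp H. m \<cdot> c \<in> Z)"
    by (rule subset_perp_iff[OF M])
  finally show ?thesis
    by (auto simp: set_mult_def)
qed

text \<open>Condition (b) turns the left side into a product of \<open>a\<close> with
  \<open>c \<cdot> b\<close>, and condition (a) swaps these two factors.\<close>

lemma exchange_iff:
  assumes "a \<in> P" "b \<in> P" "c \<in> P"
  shows "(a \<cdot> b) \<cdot> c \<in> Z \<longleftrightarrow> (c \<cdot> b) \<cdot> a \<in> Z"
  using assms by (simp add: shift swap[of a "c \<cdot> b"] mult_closed)

lemma soundness:
  assumes "derivable \<Gamma>" and v: "\<And>a. fact (v a)"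
  shows "valid v \<Gamma>"
proof -
  note fct = fact_interp[of v, OF v]
  note pp = fact_perp_perp[OF fct]
  note sub = fact_subset[OF fct]
  note valid2 = unit_mem_par_fact[OF fct]
  \<comment> \<open>Contraposition for facts: the semantic form of two-formula exchange, used to
    move the active formula to the convenient side.\<close>
  have comm: "perp (interp v A) \<subseteq> interp v B \<longleftrightarrow> perp (interp v B) \<subseteq> interp v A" for A B
    by (metis perp_antimono pp)
  show ?thesis
    using assms(1)
  proof (induction rule: derivable.induct)
    case (ax A)
    then show ?case by (simp add: valid2 interp_neg[of v, OF v] pp)
  next
    case (cut A B C)
    then have "perp (interp v A) \<subseteq> interp v B" "interp v A \<subseteq> interp v C"
      by (simp_all add: valid2 interp_neg[of v, OF v] pp)
    then have "perp (interp v B) \<subseteq> interp v C"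
      using comm by blast
    then show ?case by (simp add: valid2)
  next
    case (exchange1 A1 A2)
    then show ?case by (simp add: valid2 comm)
  next
    case (exchange2 A1 A2 A3)
    then show ?case
      using exchange_iff perp_subset
      by (simp add: unit_mem_par_fact3[OF fct]) (meson subsetD)
  next
    case (top A)
    have "perp (interp v A) \<subseteq> P" by (rule perp_subset)
    then show ?case using comm[of Top A] by (simp add: valid2)
  next
    case ("with" A C B)
    \<comment> \<open>After exchange both premises bound the same set
      \<open>perp (interp v C)\<close>, which therefore lies in the intersection.\<close>
    have "perp (interp v C) \<subseteq> interp v (With A B)"
      using "with" comm by (simp add: valid2 with_fact_def)
    then have "perp (interp v (With A B)) \<subseteq> interp v C"
      using comm by blast
    then show ?case by (simp add: valid2)
  next
    case (plus1 A C B)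
    then show ?case
      by (auto simp: valid2 perp_plus_fact sub)
  next
    case (plus2 A C B)
    then show ?case
      by (auto simp: valid2 perp_plus_fact sub)
  next
    case one
    have "unit \<in> perp Z"
      using Z_subset by (auto simp: perp_def unit_closed unit_left)
    then show ?case by simp
  next
    case (bot A)
    \<comment> \<open>The premise puts \<open>unit\<close> in \<open>interp v A\<close>, so
      \<open>a \<cdot> unit\<close>, which is \<open>a\<close>, lies in \<open>Z\<close>.\<close>
    have "a \<in> Z" if "a \<in> perp (interp v A)" for a
      using that bot unit_right[of a] by (auto simp: perp_def)
    then have "perp (interp v A) \<subseteq> perp (perp Z)"
      using subset_perp_perp[OF Z_subset] by blast
    then show ?case
      using comm[of NegOne A] by (simp add: valid2)
  next
    case (tensor A C B D)
    then have C: "perp (interp v C) \<subseteq> interp v A" and D: "perp (interp v D) \<subseteq> interp v B"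
      using comm by (simp_all add: valid2)
    \<comment> \<open>The premises place \<open>c\<close> in \<open>interp v A\<close> and
      \<open>d\<close> in \<open>interp v B\<close>, so \<open>t\<close> is orthogonal to their
      product.\<close>
    have "c \<cdot> d \<cdot> t \<in> Z"
      if cd: "c \<in> perp (interp v C)" "d \<in> perp (interp v D)"
        and t: "t \<in> perp (set_mult (interp v A) (interp v B))" for c d t
    proof -
      have "c \<cdot> d \<in> set_mult (interp v A) (interp v B)"
        using cd C D by (auto simp: set_mult_def)
      then have "t \<cdot> (c \<cdot> d) \<in> Z"
        using t by (simp add: perp_def)
      then show ?thesis
        using cd t perp_subset by (meson mult_closed subsetD swap)
    qed
    moreover have "perp (tensor_fact (interp v A) (interp v B)) = perp (set_mult (interp v A) (interp v B))"
      by (simp add: tensor_fact_def perp_perp_perp set_mult_subset sub)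
    ultimately show ?case
      by (simp add: unit_mem_par_fact3[OF fct[of "Tensor A B", simplified]])
  next
    case (par A B \<sigma>)
    \<comment> \<open>Since \<open>foldl\<close> associates to the left, premise and conclusion
      unfold to the same formula.\<close>
    then show ?case by simp
  qed
qed

end

theorem theorem1:
  fixes \<Gamma> :: "'a form list"
    and P Z :: "'p set"
    and mult :: "'p \<Rightarrow> 'p \<Rightarrow> 'p"
    and unit :: 'p
    and v :: "'a \<Rightarrow> 'p set"
  assumes "derivable \<Gamma>"
    and "q_structure P Z mult unit"
    and "\<And>a. q_structure.fact P Z mult (v a)"
  shows "q_structure.valid P Z mult unit v \<Gamma>"
  by (rule q_structure.soundness[OF assms(2,1)]) (rule assms(3))

end
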